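(* Let $G$ be an infinite abelian group. (i) One has $E_G(h,k)=0$ for all integers $h,k\ge 1$ if and only if $G$ contains no proper subgroup of finite index. (ii) If $G$ admits $(\mathbf{Z}/2\mathbf{Z})^d$ as a quotient for every $d\ge 1$, then for every integer $h\ge 1$ one has $E_G(h,k)\ge (h-1)(2k-1)$ for infinitely many integers $k$.
   Context: For subsets $A,B$ of an abelian semigroup, $A\sim B$ means that the symmetric difference of $A$ and $B$ is finite. $hA$ denotes the $h$-fold Minkowski sum $A+\cdots+A$ ($h\ge 1$ copies). A subset $A\subset G$ is an additive basis of $G$ if $hA\sim G$ for some integer $h\ge 1$. Let $A$ be an additive basis. A subset $F\subset A$ is exceptional if $A\setminus F$ is not an additive basis of $G$. An essential subset of $A$ is a finite exceptional subset of $A$ that is minimal, with respect to inclusion, among the exceptional subsets of $A$. For integers $h,k\ge 1$, $E_G(h,k)$ is the maximum, over all $A\subset G$ with $hA\sim G$, of the number of essential subsets $F$ of $A$ with $|F|=k$ (a priori a supremum, possibly infinite). *)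

theory Defs
  imports "HOL-Algebra.Algebra" "HOL-Library.Extended_Nat"
begin

text \<open>
  An abelian group is a \<^locale>\<open>comm_group\<close>; its operation is therefore written
  multiplicatively, and the Minkowski sum of two subsets is \<^const>\<open>set_mult\<close>.
\<close>

text \<open>For \<open>A \<subseteq> carrier G\<close> and \<open>h \<ge> 1\<close> the neutral starting value disappears and this is the
  sum of \<open>h\<close> copies of \<open>A\<close>.\<close>

primrec nfold_sumset :: "('a, 'b) monoid_scheme \<Rightarrow> nat \<Rightarrow> 'a set \<Rightarrow> 'a set" where
  "nfold_sumset G 0 A = {\<one>\<^bsub>G\<^esub>}"
| "nfold_sumset G (Suc h) A = nfold_sumset G h A <#>\<^bsub>G\<^esub> A"

definition almost_eq :: "'a set \<Rightarrow> 'a set \<Rightarrow> bool" (infix \<open>\<sim>\<^sub>f\<close> 50) where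
  "A \<sim>\<^sub>f B \<longleftrightarrow> finite (sym_diff A B)"

definition additive_basis :: "('a, 'b) monoid_scheme \<Rightarrow> 'a set \<Rightarrow> bool" where
  "additive_basis G A \<longleftrightarrow>
     A \<subseteq> carrier G \<and> (\<exists>h\<ge>1. nfold_sumset G h A \<sim>\<^sub>f carrier G)"

definition exceptional :: "('a, 'b) monoid_scheme \<Rightarrow> 'a set \<Rightarrow> 'a set \<Rightarrow> bool" where
  "exceptional G A F \<longleftrightarrow> F \<subseteq> A \<and> \<not> additive_basis G (A - F)"

definition essential :: "('a, 'b) monoid_scheme \<Rightarrow> 'a set \<Rightarrow> 'a set \<Rightarrow> bool" where
  "essential G A F \<longleftrightarrow>
     finite F \<and> exceptional G A F \<and> (\<forall>F'. exceptional G A F' \<and> F' \<subseteq> F \<longrightarrow> F' = F)"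

text \<open>Cardinality with value \<open>\<infinity>\<close> (rather than \<open>0\<close>) on infinite sets.\<close>

definition ecard :: "'a set \<Rightarrow> enat" where
  "ecard S = (if finite S then enat (card S) else \<infinity>)"

definition max_essential :: "('a, 'b) monoid_scheme \<Rightarrow> nat \<Rightarrow> nat \<Rightarrow> enat" where
  "max_essential G h k =
     (SUP A \<in> {A. A \<subseteq> carrier G \<and> nfold_sumset G h A \<sim>\<^sub>f carrier G}.
        ecard {F. essential G A F \<and> card F = k})"

lemma nfold_sumset_1:
  assumes "group G" "A \<subseteq> carrier G"
  shows "nfold_sumset G 1 A = A"
proof -
  interpret group G by fact
  show ?thesis using assms(2) by (force simp: set_mult_def)
qed

end

theory Submission
  imports Defs
begin

text \<open>
  (i) If \<open>F\<close> is essential in a basis \<open>A\<close>, put \<open>B = A - F\<close> and pick \<open>a \<in> F\<close>; by minimality \<open>B \<union> {a}\<close>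
  is a basis but \<open>B\<close> is not. Were \<open>a\<close> in the coset \<open>b + H\<close> of the group \<open>H\<close> generated by \<open>B - B\<close>,
  \<open>a\<close> could be traded for elements of \<open>B\<close> and \<open>B\<close> would be a basis. So \<open>H\<close> is proper, and it has finite index
  because a basis meeting finitely many cosets of \<open>H\<close> forces there to be finitely many. Conversely,
  a proper subgroup of finite index together with coset representatives is a basis, and removing the
  representatives destroys it.

  (ii) Map \<open>G\<close> onto \<open>V\<^sup>m\<close> with \<open>V = (\<int>/2)\<^sup>d\<close> and \<open>m = h - 1\<close>, and let \<open>A\<close> be the kernel together with
  one lift of each nonzero element of each factor. Each of the \<open>2\<^sup>d - 1\<close> nontrivial characters of
  each factor gives an essential subset, namely the \<open>2\<^sup>d\<^sup>-\<^sup>1\<close> elements of \<open>A\<close> on which it is nontrivial.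
\<close>

section \<open>Parity of intersections with a fixed finite set\<close>

lemma even_card_sym_diff:
  assumes "finite P" "finite Q"
  shows "even (card (sym_diff P Q)) \<longleftrightarrow> (even (card P) \<longleftrightarrow> even (card Q))"
proof -
  have "card P = card (P - Q) + card (P \<inter> Q)" "card Q = card (Q - P) + card (P \<inter> Q)"
    using card_Int_Diff[OF assms(1), of Q] card_Int_Diff[OF assms(2), of P]
    by (simp_all add: Int_commute)
  moreover have "card (sym_diff P Q) = card (P - Q) + card (Q - P)"
    using assms by (intro card_Un_disjoint) auto
  ultimately show ?thesis by presburger
qed

text \<open>Toggling a fixed \<open>t\<close> in \<open>T\<close> is an involution on the subsets of
  \<open>I\<close> that flips the parity of the intersection with \<open>T\<close>, so exactly half
  of the subsets are odd.\<close>

lemma card_odd_Int: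
  assumes "finite I" "T \<subseteq> I" "T \<noteq> {}"
  shows "card {P. P \<subseteq> I \<and> odd (card (P \<inter> T))} = 2 ^ (card I - 1)"
proof -
  let ?O = "{P. P \<subseteq> I \<and> odd (card (P \<inter> T))}"
  let ?E = "{P. P \<subseteq> I \<and> even (card (P \<inter> T))}"
  from assms obtain t where t: "t \<in> T" "t \<in> I" by blast
  let ?f = "\<lambda>P. sym_diff P {t}"
  have parity: "even (card (?f P \<inter> T)) \<longleftrightarrow> odd (card (P \<inter> T))" if "P \<subseteq> I" for P
  proof -
    have "?f P \<inter> T = sym_diff (P \<inter> T) {t}" using t by blast
    moreover have "finite (P \<inter> T)" using assms that by (meson finite_Int finite_subset)
    ultimately show ?thesis using even_card_sym_diff[of "P \<inter> T" "{t}"] by simp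
  qed
  have "?f (?f P) = P" for P by auto
  then have "bij_betw ?f ?O ?E"
    using t parity by (intro bij_betw_byWitness[where f' = ?f]) auto
  then have "card ?O = card ?E" by (rule bij_betw_same_card)
  moreover have "card (Pow I) = card ?O + card ?E"
    using assms(1) by (subst card_Un_disjoint[symmetric]) (auto intro: arg_cong[where f = card])
  moreover have "2 ^ card I = 2 * (2::nat) ^ (card I - 1)"
    using t assms(1) by (metis card_gt_0_iff empty_iff power_eq_if less_not_refl2)
  ultimately show ?thesis using assms(1) by (simp add: card_Pow)
qed

section \<open>Sumsets and additive bases in an abelian group\<close>

context comm_group
begin

lemma nfold_sumset_closed:
  assumes "A \<subseteq> carrier G"
  shows "nfold_sumset G n A \<subseteq> carrier G"
  using assms by (induction n) (auto simp: set_mult_def)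

lemma nfold_sumset_subgroup:
  assumes "subgroup H G" "A \<subseteq> H"
  shows "nfold_sumset G n A \<subseteq> H"
  using assms by (induction n) (auto simp: set_mult_def subgroup.one_closed intro!: subgroup.m_closed)

lemma nfold_sumset_SucI:
  assumes "x \<in> nfold_sumset G n A" "a \<in> A"
  shows "x \<otimes> a \<in> nfold_sumset G (Suc n) A"
  using assms by (auto simp: set_mult_def)

lemma nfold_sumset_SucE:
  assumes "z \<in> nfold_sumset G (Suc n) A"
  obtains x a where "x \<in> nfold_sumset G n A" "a \<in> A" "z = x \<otimes> a"
  using assms by (auto simp: set_mult_def)

lemma nfold_sumset_add:
  assumes A: "A \<subseteq> carrier G"
    and x: "x \<in> nfold_sumset G m A" and "y \<in> nfold_sumset G n A"
  shows "x \<otimes> y \<in> nfold_sumset G (m + n) A"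
  using \<open>y \<in> nfold_sumset G n A\<close>
proof (induction n arbitrary: y)
  case 0
  then show ?case using x subsetD[OF nfold_sumset_closed[OF A] x] by simp
next
  case (Suc n)
  then obtain u a where u: "u \<in> nfold_sumset G n A" "a \<in> A" "y = u \<otimes> a"
    by (meson nfold_sumset_SucE)
  then have "x \<otimes> y = (x \<otimes> u) \<otimes> a"
    using x nfold_sumset_closed[OF A] A by (metis m_assoc subsetD)
  then show ?case using Suc.IH[OF u(1)] u(2) nfold_sumset_SucI by simp
qed

lemma additive_basisI:
  assumes "A \<subseteq> carrier G" "h \<ge> 1" "finite (carrier G - nfold_sumset G h A)"
  shows "additive_basis G A"
  unfolding additive_basis_def almost_eq_def
  using assms nfold_sumset_closed[OF assms(1)]
  by (metis Diff_eq_empty_iff finite_Un finite.emptyI)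

lemma additive_basisE:
  assumes "additive_basis G A"
  obtains h where "A \<subseteq> carrier G" "h \<ge> 1" "finite (carrier G - nfold_sumset G h A)"
  using assms unfolding additive_basis_def almost_eq_def by auto

lemma additive_basis_infinite:
  assumes "infinite (carrier G)" "additive_basis G A"
  shows "infinite A"
proof
  assume "finite A"
  then have "finite (nfold_sumset G n A)" for n
    by (induction n) (auto simp: set_mult_def)
  with assms show False by (meson additive_basisE finite_Diff2)
qed

section \<open>Subgroups of finite index and essential subsets\<close>

lemma not_additive_basis_if_subset_subgroup:
  assumes "infinite (carrier G)" "subgroup H G" "H \<noteq> carrier G" "A \<subseteq> H"
  shows "\<not> additive_basis G A"
proof
  assume "additive_basis G A"
  then obtain h where "finite (carrier G - nfold_sumset G h A)" by (meson additive_basisE)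
  then have fin: "finite (carrier G - H)"
    using nfold_sumset_subgroup[OF assms(2,4)] by (meson Diff_mono finite_subset order_refl)
  interpret H: subgroup H G by fact
  obtain x where x: "x \<in> carrier G" "x \<notin> H" using assms(3) H.subset by blast
  \<comment> \<open>A whole coset of \<open>H\<close> fits into the finite complement; being in
    bijection with \<open>H\<close>, it forces \<open>H\<close> and then \<open>G\<close> to be
    finite.\<close>
  have "(\<otimes>) x ` H \<subseteq> carrier G - H"
  proof
    fix y assume "y \<in> (\<otimes>) x ` H"
    then obtain z where z: "z \<in> H" "y = x \<otimes> z" by blast
    then have "y \<otimes> inv z = x" using x by (simp add: m_assoc)
    then show "y \<in> carrier G - H" using x z H.m_closed[of y "inv z"] by auto
  qed
  then have "finite ((\<otimes>) x ` H)" using fin finite_subset by blast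
  moreover have "inj_on ((\<otimes>) x) H" using x by (auto intro!: inj_onI)
  ultimately have "finite H" using finite_imageD by blast
  with fin have "finite (carrier G)" by simp
  with assms(1) show False ..
qed

text \<open>In the quotient by \<open>H\<close>, classes of a sumset are products of classes of its
  summands, hence finitely many; the finitely many elements outside the sumset contribute finitely
  many more.\<close>

lemma finite_rcosets_if_additive_basis:
  assumes "subgroup H G" "additive_basis G A" "finite ((#>) H ` A)"
  shows "finite (rcosets H)"
proof -
  interpret H: normal H G using assms(1) by (rule subgroup_imp_normal)
  from assms(2) obtain h where A: "A \<subseteq> carrier G"
    and cofin: "finite (carrier G - nfold_sumset G h A)" by (meson additive_basisE)
  have fin: "finite ((#>) H ` nfold_sumset G n A)" for n
  proof (induction n)
    case (Suc n)
    have "(#>) H ` nfold_sumset G (Suc n) A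
        \<subseteq> (\<lambda>(U, V). U <#> V) ` ((#>) H ` nfold_sumset G n A \<times> (#>) H ` A)"
    proof
      fix U assume "U \<in> (#>) H ` nfold_sumset G (Suc n) A"
      then obtain z where "z \<in> nfold_sumset G (Suc n) A" "U = H #> z" by blast
      then obtain x a where xa: "x \<in> nfold_sumset G n A" "a \<in> A" and "U = H #> (x \<otimes> a)"
        by (elim nfold_sumset_SucE) blast
      then have "U = (H #> x) <#> (H #> a)"
        using A nfold_sumset_closed[OF A] by (metis H.rcos_sum subsetD)
      with xa show "U \<in> (\<lambda>(U, V). U <#> V) ` ((#>) H ` nfold_sumset G n A \<times> (#>) H ` A)"
        by force
    qed
    then show ?case by (rule finite_subset) (use Suc assms(3) in blast)
  qed simp
  have "rcosets H \<subseteq> (#>) H ` nfold_sumset G h A \<union> (#>) H ` (carrier G - nfold_sumset G h A)"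
    unfolding RCOSETS_def by blast
  then show ?thesis by (rule finite_subset) (use fin cofin in blast)
qed

text \<open>Since \<open>G\<close> is abelian, this is the subgroup generated by the differences of elements of \<open>B\<close>.\<close>

definition difference_subgroup :: "'a set \<Rightarrow> 'a set" where
  "difference_subgroup B =
     {z \<in> carrier G. \<exists>n. \<exists>x \<in> nfold_sumset G n B. \<exists>y \<in> nfold_sumset G n B. z \<otimes> x = y}"

lemma subgroup_difference_subgroup:
  assumes B: "B \<subseteq> carrier G"
  shows "subgroup (difference_subgroup B) G"
proof
  show "difference_subgroup B \<subseteq> carrier G" by (auto simp: difference_subgroup_def)
  have "\<one> \<in> nfold_sumset G 0 B" by simp
  then show "\<one> \<in> difference_subgroup B"
    unfolding difference_subgroup_def using l_one one_closed by blast
  fix z assume "z \<in> difference_subgroup B"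
  then obtain n x y where z: "z \<in> carrier G"
    "x \<in> nfold_sumset G n B" "y \<in> nfold_sumset G n B" "z \<otimes> x = y"
    unfolding difference_subgroup_def by blast
  then have car: "x \<in> carrier G" "y \<in> carrier G" using nfold_sumset_closed[OF B] by auto
  have "inv z \<otimes> y = x" using z car by (metis inv_solve_left)
  then show "inv z \<in> difference_subgroup B"
    unfolding difference_subgroup_def using z inv_closed by blast
  fix w assume "w \<in> difference_subgroup B"
  then obtain m u v where w: "w \<in> carrier G"
    "u \<in> nfold_sumset G m B" "v \<in> nfold_sumset G m B" "w \<otimes> u = v"
    unfolding difference_subgroup_def by blast
  then have "u \<in> carrier G" using nfold_sumset_closed[OF B] by auto
  then have "(z \<otimes> w) \<otimes> (x \<otimes> u) = y \<otimes> v"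
    unfolding z(4)[symmetric] w(4)[symmetric] using z(1) w(1) car by (simp add: m_ac)
  then show "z \<otimes> w \<in> difference_subgroup B"
    unfolding difference_subgroup_def
    using z w nfold_sumset_add[OF B z(2) w(2)] nfold_sumset_add[OF B z(3) w(3)] by blast
qed

lemma difference_subgroupI:
  assumes B: "B \<subseteq> carrier G" and "b \<in> B" "c \<in> B"
  shows "b \<otimes> inv c \<in> difference_subgroup B"
proof -
  have "b \<in> nfold_sumset G 1 B" "c \<in> nfold_sumset G 1 B"
    using assms nfold_sumset_1[OF is_group B] by auto
  moreover have "b \<otimes> inv c \<otimes> c = b" using assms by (simp add: m_assoc subset_iff)
  ultimately show ?thesis
    unfolding difference_subgroup_def using assms by blast
qed

text \<open>If \<open>a + x\<close> is a sum of \<open>n + 1\<close> elements of \<open>B\<close> for some \<open>x \<in> nB\<close>, then translating by \<open>hx\<close>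
  moves all of \<open>h(B \<union> {a})\<close> into \<open>h(n + 1)B\<close>.\<close>

lemma additive_basis_remove1:
  assumes basis: "additive_basis G (insert a B)"
    and b: "b \<in> B" and ab: "a \<otimes> inv b \<in> difference_subgroup B"
  shows "additive_basis G B"
proof -
  from basis obtain h where h: "h \<ge> 1" and AG: "insert a B \<subseteq> carrier G"
    and cofin: "finite (carrier G - nfold_sumset G h (insert a B))" by (meson additive_basisE)
  then have B: "B \<subseteq> carrier G" and aG: "a \<in> carrier G" and bG: "b \<in> carrier G" using b by auto
  obtain n x y where x: "x \<in> nfold_sumset G n B" and y: "y \<in> nfold_sumset G n B"
    and xy: "a \<otimes> inv b \<otimes> x = y" using ab unfolding difference_subgroup_def by blast
  have xG: "x \<in> carrier G" using x nfold_sumset_closed[OF B] by auto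
  have "inv b \<otimes> (b \<otimes> x) = x" using bG xG by (simp add: m_assoc[symmetric])
  then have "a \<otimes> x = y \<otimes> b"
    unfolding xy[symmetric] using aG bG xG by (simp add: m_assoc m_comm[OF xG bG])
  then have step: "c \<otimes> x \<in> nfold_sumset G (Suc n) B" if "c \<in> insert a B" for c
    using that nfold_sumset_SucI[OF y b] nfold_sumset_SucI[OF x, of c] B xG
    by (metis insert_iff m_comm subsetD)
  \<comment> \<open>Each of the \<open>i\<close> summands absorbs one copy of \<open>x\<close> by
    \<open>step\<close> and becomes a sum of \<open>Suc n\<close> elements of
    \<open>B\<close>.\<close>
  have shift: "z \<otimes> x [^] i \<in> nfold_sumset G (i * Suc n) B"
    if "z \<in> nfold_sumset G i (insert a B)" for i z
    using that
  proof (induction i arbitrary: z)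
    case (Suc i)
    then obtain u c where u: "u \<in> nfold_sumset G i (insert a B)" "c \<in> insert a B" "z = u \<otimes> c"
      by (meson nfold_sumset_SucE)
    then have "u \<in> carrier G" "c \<in> carrier G" using nfold_sumset_closed[OF AG] AG by auto
    then have "z \<otimes> x [^] Suc i = (c \<otimes> x) \<otimes> (u \<otimes> x [^] i)"
      using u(3) xG by (simp add: m_ac)
    then show ?case
      using nfold_sumset_add[OF B step[OF u(2)] Suc.IH[OF u(1)]] by (metis mult_Suc)
  qed simp
  let ?t = "x [^] h"
  \<comment> \<open>Contrapositive of \<open>shift\<close>: an element missed by the sumset of
    \<open>B\<close>, once divided by \<open>?t\<close>, is missed by the sumset of
    \<open>insert a B\<close>.\<close>
  have "carrier G - nfold_sumset G (h * Suc n) B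
      \<subseteq> (\<lambda>z. z \<otimes> ?t) ` (carrier G - nfold_sumset G h (insert a B))"
  proof
    fix g assume g: "g \<in> carrier G - nfold_sumset G (h * Suc n) B"
    then have eq: "g = (g \<otimes> inv ?t) \<otimes> ?t" using xG by (simp add: m_assoc)
    then have "g \<otimes> inv ?t \<notin> nfold_sumset G h (insert a B)" using g shift by fastforce
    then show "g \<in> (\<lambda>z. z \<otimes> ?t) ` (carrier G - nfold_sumset G h (insert a B))"
      using eq g xG by blast
  qed
  then have "finite (carrier G - nfold_sumset G (h * Suc n) B)"
    using cofin finite_surj by blast
  then show ?thesis using h B by (intro additive_basisI[of B "h * Suc n"]) auto
qed

lemma essential_imp_finite_index_subgroup:
  assumes inf: "infinite (carrier G)" and A: "additive_basis G A"
    and F: "essential G A F" and "F \<noteq> {}"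
  shows "\<exists>H. subgroup H G \<and> H \<noteq> carrier G \<and> finite (rcosets H)"
proof -
  from F have fin: "finite F" and FA: "F \<subseteq> A" and nb: "\<not> additive_basis G (A - F)"
    and min: "\<And>F'. exceptional G A F' \<Longrightarrow> F' \<subseteq> F \<Longrightarrow> F' = F"
    unfolding essential_def exceptional_def by auto
  let ?B = "A - F" and ?H = "difference_subgroup (A - F)"
  have AG: "A \<subseteq> carrier G" using A by (meson additive_basisE)
  then have B: "?B \<subseteq> carrier G" by blast
  from \<open>F \<noteq> {}\<close> obtain a where a: "a \<in> F" by blast
  have "infinite ?B" using additive_basis_infinite[OF inf A] fin by simp
  then obtain b where b: "b \<in> ?B" by (metis finite.emptyI ex_in_conv)
  \<comment> \<open>Minimality of \<open>F\<close>: putting the single element \<open>a\<close> back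
    must restore a basis.\<close>
  have "\<not> exceptional G A (F - {a})" using min[of "F - {a}"] a by blast
  moreover have "A - (F - {a}) = insert a ?B" using a FA by blast
  ultimately have basis: "additive_basis G (insert a ?B)"
    using FA unfolding exceptional_def by auto
  have sub: "subgroup ?H G" using B by (rule subgroup_difference_subgroup)
  have "a \<otimes> inv b \<notin> ?H" using additive_basis_remove1[OF basis b] nb by blast
  moreover have "a \<otimes> inv b \<in> carrier G" using a b FA AG by blast
  ultimately have "?H \<noteq> carrier G" by blast
  \<comment> \<open>All of \<open>?B\<close> lies in one coset of \<open>?H\<close>, so the basis
    \<open>insert a ?B\<close> meets at most two cosets.\<close>
  moreover have "finite ((#>) ?H ` insert a ?B)"
  proof -
    have "?H #> c = ?H #> b" if "c \<in> ?B" for c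
    proof -
      have c: "c \<in> carrier G" "b \<in> carrier G" using that b B by auto
      then have "c = (c \<otimes> inv b) \<otimes> b" by (simp add: m_assoc)
      then have "c \<in> ?H #> b"
        using difference_subgroupI[OF B that b] unfolding r_coset_def by blast
      then show ?thesis using repr_independence[OF _ c(2) sub] by simp
    qed
    then have "(#>) ?H ` ?B \<subseteq> {?H #> b}" by blast
    then have "finite ((#>) ?H ` ?B)" using finite_subset by blast
    then show ?thesis by simp
  qed
  ultimately show ?thesis
    using finite_rcosets_if_additive_basis[OF sub basis] sub by blast
qed

lemma finite_index_subgroup_imp_essential:
  assumes inf: "infinite (carrier G)"
    and H: "subgroup H G" "H \<noteq> carrier G" "finite (rcosets H)"
  obtains A F where "A \<subseteq> carrier G" "nfold_sumset G 2 A = carrier G"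
    "essential G A F" "F \<noteq> {}"
proof -
  interpret H: subgroup H G by fact
  define r where "r U = (SOME x. x \<in> carrier G \<and> U = H #> x)" for U
  have r: "r U \<in> carrier G" "H #> r U = U" if "U \<in> rcosets H" for U
    using that someI_ex[of "\<lambda>x. x \<in> carrier G \<and> U = H #> x"]
    unfolding r_def RCOSETS_def by auto
  \<comment> \<open>Representatives that happen to lie in \<open>H\<close> are left out, so that
    removing \<open>R\<close> from the basis leaves exactly \<open>H\<close>.\<close>
  define R where "R = r ` (rcosets H) - H"
  let ?A = "H \<union> r ` (rcosets H)"
  have AG: "?A \<subseteq> carrier G" using r H.subset by auto
  have "nfold_sumset G 1 ?A = ?A" using nfold_sumset_1[OF is_group AG] .
  have "g \<in> nfold_sumset G 2 ?A" if g: "g \<in> carrier G" for g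
  proof -
    have U: "H #> g \<in> rcosets H" using g unfolding RCOSETS_def by blast
    have "g \<in> H #> r (H #> g)" using r(2)[OF U] rcos_self[OF g H(1)] by simp
    then obtain z where "z \<in> H" "g = z \<otimes> r (H #> g)" unfolding r_coset_def by blast
    moreover have "z \<in> nfold_sumset G 1 ?A" if "z \<in> H" for z
      using that nfold_sumset_1[OF is_group AG] by simp
    ultimately show ?thesis
      using nfold_sumset_SucI[of z 1 ?A "r (H #> g)"] U
      by (metis Suc_1 UnCI imageI)
  qed
  then have two: "nfold_sumset G 2 ?A = carrier G"
    using nfold_sumset_closed[OF AG] by blast
  then have basis: "additive_basis G ?A" using AG by (intro additive_basisI[of _ 2]) auto
  let ?P = "\<lambda>F. F \<subseteq> R \<and> exceptional G ?A F"
  have "?A - R = H" unfolding R_def by auto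
  then have "exceptional G ?A R"
    unfolding exceptional_def
    using not_additive_basis_if_subset_subgroup[OF inf H(1,2)] by (auto simp: R_def)
  then have "?P R" by blast
  moreover have finR: "finite R" unfolding R_def using H(3) by simp
  then have "finite {F. ?P F}" using finite_subset[of "{F. ?P F}" "Pow R"] by auto
  ultimately obtain F where F: "?P F" "\<And>F'. ?P F' \<Longrightarrow> F' \<subseteq> F \<Longrightarrow> F' = F"
    using finite_has_minimal[of "{F. ?P F}"] by (metis (mono_tags, lifting) empty_iff mem_Collect_eq)
  \<comment> \<open>Minimality among the exceptional subsets of \<open>R\<close> is enough, since
    every subset of \<open>F\<close> is a subset of \<open>R\<close>.\<close>
  then have "essential G ?A F"
    unfolding essential_def using finR finite_subset by (meson subset_trans)
  moreover have "F \<noteq> {}" using F(1) basis unfolding exceptional_def by auto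
  ultimately show ?thesis using that[OF AG two] by blast
qed

lemma max_essential_eq_0_iff:
  "max_essential G h k = 0 \<longleftrightarrow>
     (\<forall>A F. A \<subseteq> carrier G \<and> nfold_sumset G h A \<sim>\<^sub>f carrier G \<and> essential G A F \<longrightarrow> card F \<noteq> k)"
proof -
  \<comment> \<open>An infinite family has \<open>ecard\<close> equal to infinity, so the value 0
    really means that the family is empty.\<close>
  have "ecard S = 0 \<longleftrightarrow> S = {}" for S :: "'a set set"
    by (auto simp: ecard_def zero_enat_def)
  then show ?thesis
    unfolding max_essential_def bot_enat_def[symmetric] SUP_bot_conv by auto
qed

theorem max_essential_eq_0_iff_no_finite_index:
  assumes inf: "infinite (carrier G)"
  shows "(\<forall>h k. h \<ge> 1 \<and> k \<ge> 1 \<longrightarrow> max_essential G h k = 0) \<longleftrightarrow>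
    \<not> (\<exists>H. subgroup H G \<and> H \<noteq> carrier G \<and> finite (rcosets H))" (is "?L \<longleftrightarrow> \<not> ?R")
proof
  assume ?L
  show "\<not> ?R"
  proof
    assume ?R
    then obtain A F where AF: "A \<subseteq> carrier G" "nfold_sumset G 2 A = carrier G"
      "essential G A F" "F \<noteq> {}"
      by (meson finite_index_subgroup_imp_essential[OF inf])
    then have "card F \<ge> 1" by (simp add: essential_def Suc_le_eq card_gt_0_iff)
    with \<open>?L\<close> have "max_essential G 2 (card F) = 0" by simp
    moreover have "nfold_sumset G 2 A \<sim>\<^sub>f carrier G" using AF by (simp add: almost_eq_def)
    ultimately show False using AF unfolding max_essential_eq_0_iff by blast
  qed
next
  assume nR: "\<not> ?R"
  \<comment> \<open>The condition \<open>k \<ge> 1\<close> makes an essential subset of size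
    \<open>k\<close> nonempty, and \<open>h \<ge> 1\<close> makes \<open>A\<close> an additive
    basis.\<close>
  show ?L
    unfolding max_essential_eq_0_iff
    using essential_imp_finite_index_subgroup[OF inf] nR
    by (metis additive_basis_def card.empty not_one_le_zero)
qed

lemma le_max_essentialI:
  assumes "A \<subseteq> carrier G" "nfold_sumset G h A \<sim>\<^sub>f carrier G"
    and "inj_on f \<T>" and "\<And>T. T \<in> \<T> \<Longrightarrow> essential G A (f T) \<and> card (f T) = k"
  shows "enat (card \<T>) \<le> max_essential G h k"
proof -
  let ?E = "{F. essential G A F \<and> card F = k}"
  have "f ` \<T> \<subseteq> ?E" using assms(4) by blast
  then have "finite ?E \<Longrightarrow> card \<T> \<le> card ?E"
    using card_mono[of ?E "f ` \<T>"] card_image[OF assms(3)] by simp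
  then have "enat (card \<T>) \<le> ecard ?E" by (simp add: ecard_def)
  also have "\<dots> \<le> max_essential G h k"
    unfolding max_essential_def using assms(1,2) by (intro SUP_upper) blast
  finally show ?thesis .
qed

end

section \<open>Many essential subsets from an elementary abelian 2-quotient\<close>

text \<open>A surjective homomorphism \<open>S\<close> onto \<open>(\<int>/2)\<^sup>m\<^sup>d\<close>, whose elements are encoded as sets of
  coordinates with the symmetric difference as the operation; the coordinates are divided into
  \<open>m\<close> blocks of size \<open>d\<close>. The characters of the target are the maps
  \<open>P \<mapsto> (-1)^card (P \<inter> T)\<close>.\<close>

locale boolean_quotient = comm_group G for G (structure) +
  fixes S :: "'a \<Rightarrow> 'c set" and I :: "nat \<Rightarrow> 'c set" and m d :: nat
  assumes inf: "infinite (carrier G)"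
    and S_mult: "x \<in> carrier G \<Longrightarrow> y \<in> carrier G \<Longrightarrow> S (x \<otimes> y) = sym_diff (S x) (S y)"
    and S_surj: "S ` carrier G = Pow (\<Union>j<m. I j)"
    and I_finite: "j < m \<Longrightarrow> finite (I j)"
    and I_card: "j < m \<Longrightarrow> card (I j) = d"
    and I_disjoint: "i < m \<Longrightarrow> j < m \<Longrightarrow> i \<noteq> j \<Longrightarrow> I i \<inter> I j = {}"
begin

lemma S_one: "S \<one> = {}"
  using S_mult[OF one_closed one_closed] by auto

lemma S_inv: "x \<in> carrier G \<Longrightarrow> S (inv x) = S x"
  using S_mult[of x "inv x"] S_one by auto

lemma finite_S:
  assumes "x \<in> carrier G" shows "finite (S x)"
proof (rule finite_subset)
  show "S x \<subseteq> (\<Union>j<m. I j)" using assms S_surj by blast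
  show "finite (\<Union>j<m. I j)" using I_finite by simp
qed

definition rep :: "'c set \<Rightarrow> 'a" where
  "rep P = (if P = {} then \<one> else SOME x. x \<in> carrier G \<and> S x = P)"

lemma rep: assumes "P \<subseteq> (\<Union>j<m. I j)" shows "rep P \<in> carrier G" "S (rep P) = P"
proof -
  have "\<exists>x. x \<in> carrier G \<and> S x = P" using assms S_surj by (metis PowI imageE)
  then show "rep P \<in> carrier G" "S (rep P) = P"
    using someI_ex[of "\<lambda>x. x \<in> carrier G \<and> S x = P"] S_one unfolding rep_def by auto
qed

lemma rep_block:
  assumes "j < m" "P \<subseteq> I j" shows "rep P \<in> carrier G" "S (rep P) = P"
  using rep[of P] assms by auto

text \<open>The zero element of every block lifts to \<open>\<one>\<close>, which lies in the
  kernel; the remaining lifts are those of the nonzero elements.\<close>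

definition basis :: "'a set" where
  "basis = {x \<in> carrier G. S x = {}} \<union> (\<Union>j<m. rep ` Pow (I j))"

text \<open>The part of the basis on which the character encoded by \<open>T\<close> takes the value
  -1.\<close>

definition ess :: "'c set \<Rightarrow> 'a set" where
  "ess T = {a \<in> basis. odd (card (S a \<inter> T))}"

text \<open>The members encode the nontrivial characters of the single factors.\<close>

definition block_subsets :: "'c set set" where
  "block_subsets = (\<Union>j<m. Pow (I j) - {{}})"

lemma basis_carrier: "basis \<subseteq> carrier G"
  unfolding basis_def using rep_block by auto

lemma one_in_basis: "\<one> \<in> basis"
  unfolding basis_def using S_one by simp

lemma rep_in_basis: "j < m \<Longrightarrow> P \<subseteq> I j \<Longrightarrow> rep P \<in> basis"
  unfolding basis_def by blast

text \<open>Coordinates are cleared block by block: dividing \<open>g\<close> by an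
  \<open>r\<close>-fold sum that agrees with it on a block kills that block, and after
  \<open>m\<close> blocks a kernel element remains. The full basis uses \<open>r = 1\<close>, the
  basis with some elements removed uses \<open>r = 2\<close>.\<close>

lemma nfold_sumset_eqI:
  assumes B: "B \<subseteq> carrier G" and ker: "{x \<in> carrier G. S x = {}} \<subseteq> nfold_sumset G s B"
    and step: "\<And>j P. j < m \<Longrightarrow> P \<subseteq> I j \<Longrightarrow> \<exists>x \<in> nfold_sumset G r B. S x = P"
  shows "nfold_sumset G (s + m * r) B = carrier G"
proof
  show "nfold_sumset G (s + m * r) B \<subseteq> carrier G" using B by (rule nfold_sumset_closed)
  have "g \<in> nfold_sumset G (s + i * r) B"
    if "i \<le> m" "g \<in> carrier G" "S g \<subseteq> (\<Union>j<i. I j)" for i g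
    using that
  proof (induction i arbitrary: g)
    case 0
    then show ?case using ker by auto
  next
    case (Suc i)
    then obtain x where x: "x \<in> nfold_sumset G r B" "S x = S g \<inter> I i"
      using step[of i "S g \<inter> I i"] by auto
    then have xG: "x \<in> carrier G" using nfold_sumset_closed[OF B] by blast
    have "S (g \<otimes> inv x) = S g - I i"
      using S_mult[of g "inv x"] S_inv[OF xG] x xG Suc.prems by auto
    moreover have "\<dots> \<subseteq> (\<Union>j<i. I j)" using Suc.prems(3) by (auto simp: lessThan_Suc)
    ultimately have "g \<otimes> inv x \<in> nfold_sumset G (s + i * r) B"
      using Suc xG by simp
    then have "(g \<otimes> inv x) \<otimes> x \<in> nfold_sumset G (s + i * r + r) B"
      using nfold_sumset_add[OF B] x by blast
    moreover have "(g \<otimes> inv x) \<otimes> x = g" using Suc.prems xG by (simp add: m_assoc)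
    ultimately show ?case by (simp add: algebra_simps)
  qed
  from this[of m] show "carrier G \<subseteq> nfold_sumset G (s + m * r) B" using S_surj by blast
qed

lemma nfold_sumset_basis: "nfold_sumset G (Suc m) basis = carrier G"
proof -
  have one: "nfold_sumset G 1 basis = basis" using nfold_sumset_1[OF is_group basis_carrier] .
  have "nfold_sumset G (1 + m * 1) basis = carrier G"
  proof (rule nfold_sumset_eqI[OF basis_carrier])
    show "{x \<in> carrier G. S x = {}} \<subseteq> nfold_sumset G 1 basis"
      unfolding one by (simp add: basis_def)
    show "\<exists>x \<in> nfold_sumset G 1 basis. S x = P" if "j < m" "P \<subseteq> I j" for j P
      unfolding one using rep_in_basis[OF that] rep_block(2)[OF that] by blast
  qed
  then show ?thesis by simp
qed

text \<open>A character supported on block \<open>j\<close> is trivial on the kernel and on the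
  lifts of all other blocks, so only lifts from block \<open>j\<close> can occur.\<close>

lemma ess_eq:
  assumes "j < m" "T \<subseteq> I j"
  shows "ess T = rep ` {P. P \<subseteq> I j \<and> odd (card (P \<inter> T))}"
proof
  show "ess T \<subseteq> rep ` {P. P \<subseteq> I j \<and> odd (card (P \<inter> T))}"
  proof
    fix a assume "a \<in> ess T"
    then have a: "a \<in> basis" and odd: "odd (card (S a \<inter> T))" by (auto simp: ess_def)
    then have "S a \<inter> T \<noteq> {}" by (metis card.empty even_zero)
    then obtain i P where P: "i < m" "P \<subseteq> I i" "a = rep P"
      using a unfolding basis_def by auto
    then have "S a = P" using rep_block by blast
    then have "P \<inter> T \<noteq> {}" using \<open>S a \<inter> T \<noteq> {}\<close> by simp
    then have "i = j" using I_disjoint[of i j] P assms by blast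
    then show "a \<in> rep ` {P. P \<subseteq> I j \<and> odd (card (P \<inter> T))}"
      using P odd \<open>S a = P\<close> by auto
  qed
  show "rep ` {P. P \<subseteq> I j \<and> odd (card (P \<inter> T))} \<subseteq> ess T"
    using rep_in_basis[OF assms(1)] rep_block(2)[OF assms(1)] unfolding ess_def by auto
qed

lemma card_ess:
  assumes "T \<in> block_subsets"
  shows "finite (ess T)" "card (ess T) = 2 ^ (d - 1)"
proof -
  from assms obtain j where j: "j < m" "T \<subseteq> I j" "T \<noteq> {}" unfolding block_subsets_def by auto
  have "inj_on rep (Pow (I j))"
    using rep_block(2)[OF j(1)] by (metis PowD inj_onI)
  then have "inj_on rep {P. P \<subseteq> I j \<and> odd (card (P \<inter> T))}"
    by (rule inj_on_subset) auto
  then show "card (ess T) = 2 ^ (d - 1)"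
    unfolding ess_eq[OF j(1,2)]
    using card_odd_Int[OF I_finite[OF j(1)] j(2,3)] I_card[OF j(1)] by (simp add: card_image)
  show "finite (ess T)"
    unfolding ess_eq[OF j(1,2)] using I_finite[OF j(1)] by simp
qed

text \<open>\<open>T\<close> can be read off from \<open>ess T\<close> by testing which lifts of
  singletons belong to it.\<close>

lemma inj_on_ess: "inj_on ess block_subsets"
proof -
  have "{t \<in> \<Union>j<m. I j. rep {t} \<in> ess T} = T" if "T \<in> block_subsets" for T
  proof -
    have "rep {t} \<in> ess T \<longleftrightarrow> t \<in> T" if "j < m" "t \<in> I j" for t j
      using rep_in_basis[of j "{t}"] rep_block(2)[of j "{t}"] that
      by (cases "t \<in> T") (auto simp: ess_def)
    then show ?thesis using that unfolding block_subsets_def by auto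
  qed
  then show ?thesis by (rule inj_on_inverseI)
qed

lemma card_block_subsets: "card block_subsets = m * (2 ^ d - 1)"
proof -
  have "card block_subsets = (\<Sum>j<m. card (Pow (I j) - {{}}))"
    unfolding block_subsets_def
  proof (rule card_UN_disjoint)
    show "\<forall>i\<in>{..<m}. finite (Pow (I i) - {{}})" using I_finite by simp
    show "\<forall>i\<in>{..<m}. \<forall>j\<in>{..<m}. i \<noteq> j \<longrightarrow> (Pow (I i) - {{}}) \<inter> (Pow (I j) - {{}}) = {}"
      using I_disjoint by blast
  qed simp
  also have "\<dots> = (\<Sum>j<m. 2 ^ d - 1)"
    using I_card I_finite by (intro sum.cong) (auto simp: card_Diff_singleton card_Pow)
  finally show ?thesis by simp
qed

text \<open>This says that the character encoded by \<open>T\<close> is a homomorphism; its kernel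
  is the subgroup used to show that \<open>ess T\<close> is exceptional.\<close>

lemma parity_S_mult:
  assumes "x \<in> carrier G" "y \<in> carrier G"
  shows "even (card (S (x \<otimes> y) \<inter> T)) \<longleftrightarrow> (even (card (S x \<inter> T)) \<longleftrightarrow> even (card (S y \<inter> T)))"
proof -
  have "S (x \<otimes> y) \<inter> T = sym_diff (S x \<inter> T) (S y \<inter> T)"
    using S_mult[OF assms] by blast
  then show ?thesis
    using even_card_sym_diff[of "S x \<inter> T" "S y \<inter> T"] finite_S assms by simp
qed

lemma subgroup_even: "subgroup {g \<in> carrier G. even (card (S g \<inter> T))} G"
  using parity_S_mult S_one S_inv by unfold_locales auto

text \<open>Removing \<open>ess T\<close> leaves only elements of the kernel \<open>?K\<close> of
  the character, which is a proper subgroup because it misses the lift of a singleton inside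
  \<open>T\<close>.\<close>

lemma exceptional_ess:
  assumes "T \<in> block_subsets"
  shows "exceptional G basis (ess T)"
proof -
  let ?K = "{g \<in> carrier G. even (card (S g \<inter> T))}"
  from assms obtain j t where j: "j < m" "T \<subseteq> I j" "t \<in> T" unfolding block_subsets_def by auto
  then have "rep {t} \<in> carrier G" "S (rep {t}) \<inter> T = {t}"
    using rep_block[of j "{t}"] by auto
  then have "rep {t} \<in> carrier G" "rep {t} \<notin> ?K" by simp_all
  then have "?K \<noteq> carrier G" by metis
  then have "\<not> additive_basis G (basis - ess T)"
    using basis_carrier
    by (intro not_additive_basis_if_subset_subgroup[OF inf subgroup_even]) (auto simp: ess_def)
  then show ?thesis by (auto simp: exceptional_def ess_def)
qed

text \<open>An element \<open>c\<close> of \<open>ess T\<close> that is retained compensates for the removal of any other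
  element \<open>rep P\<close> of \<open>ess T\<close>: the sum of \<open>c\<close> and \<open>rep (sym_diff P (S c))\<close> lies over \<open>P\<close>.\<close>

lemma not_exceptional_psubset_ess:
  assumes "T \<in> block_subsets" and F: "F \<subset> ess T"
  shows "\<not> exceptional G basis F"
proof -
  let ?B = "basis - F"
  from assms obtain j0 where j0: "j0 < m" "T \<subseteq> I j0" unfolding block_subsets_def by auto
  have B: "?B \<subseteq> carrier G" using basis_carrier by blast
  have notess: "b \<in> ?B" if "b \<in> basis" "even (card (S b \<inter> T))" for b
    using that F by (auto simp: ess_def)
  have one: "\<one> \<in> ?B" using notess one_in_basis S_one by simp
  from F obtain c where c: "c \<in> ess T" "c \<notin> F" by blast
  then have cB: "c \<in> ?B" by (simp add: ess_def)
  from c obtain Q where Q: "Q \<subseteq> I j0" "odd (card (Q \<inter> T))" "c = rep Q"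
    using ess_eq[OF j0] by auto
  have Sc: "S c = Q" using Q rep_block[OF j0(1)] by blast
  have one1: "nfold_sumset G 1 ?B = ?B" using nfold_sumset_1[OF is_group B] .
  have two: "x \<otimes> y \<in> nfold_sumset G 2 ?B" if "x \<in> ?B" "y \<in> ?B" for x y
    using nfold_sumset_SucI[of x 1 ?B y] that one1 by (simp add: numeral_2_eq_2)
  have "nfold_sumset G (1 + m * 2) ?B = carrier G"
  proof (rule nfold_sumset_eqI[OF B])
    show "{x \<in> carrier G. S x = {}} \<subseteq> nfold_sumset G 1 ?B"
      unfolding one1 using notess by (auto simp: basis_def)
    fix j P assume P: "j < m" "P \<subseteq> I j"
    note repP = rep_block[OF P] rep_in_basis[OF P]
    show "\<exists>x \<in> nfold_sumset G 2 ?B. S x = P"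
    proof (cases "rep P \<in> F")
      case False
      \<comment> \<open>Padding with \<open>\<one>\<close>, which survives in \<open>?B\<close>,
        gives exactly two summands.\<close>
      then have "rep P \<otimes> \<one> \<in> nfold_sumset G 2 ?B" using two one repP by blast
      then show ?thesis using repP by force
    next
      case True
      then have odd: "odd (card (P \<inter> T))" using F repP by (auto simp: ess_def)
      then have "P \<inter> T \<noteq> {}" by (metis card.empty even_zero)
      then have "j = j0" using I_disjoint[of j j0] P j0 by blast
      then have sub: "sym_diff P Q \<subseteq> I j0" using P Q by blast
      have "finite P" "finite Q" using P Q I_finite j0 by (meson finite_subset)+
      moreover have "sym_diff P Q \<inter> T = sym_diff (P \<inter> T) (Q \<inter> T)" by blast
      \<comment> \<open>The odd parities of \<open>P\<close> and \<open>Q\<close> cancel, so the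
        lift of their symmetric difference is outside \<open>ess T\<close> and has not been
        removed.\<close>
      ultimately have "even (card (sym_diff P Q \<inter> T))"
        using even_card_sym_diff[of "P \<inter> T" "Q \<inter> T"] odd Q by simp
      note b = rep_block[OF j0(1) sub]
      have "rep (sym_diff P Q) \<in> ?B"
        using notess rep_in_basis[OF j0(1) sub] b(2) \<open>even (card (sym_diff P Q \<inter> T))\<close> by metis
      then have "rep (sym_diff P Q) \<otimes> c \<in> nfold_sumset G 2 ?B" using two cB by blast
      moreover have "S (rep (sym_diff P Q) \<otimes> c) = P"
        using S_mult[OF b(1), of c] b(2) Sc cB B by blast
      ultimately show ?thesis by blast
    qed
  qed
  then have "additive_basis G ?B" using B by (intro additive_basisI[of _ "1 + m * 2"]) auto
  then show ?thesis by (simp add: exceptional_def)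
qed

lemma essential_ess:
  assumes "T \<in> block_subsets"
  shows "essential G basis (ess T)"
  unfolding essential_def
  using card_ess(1)[OF assms] exceptional_ess[OF assms] not_exceptional_psubset_ess[OF assms]
  by blast

text \<open>For \<open>d \<ge> 1\<close>, with \<open>h = Suc m\<close> and
  \<open>k = 2 ^ (d - 1)\<close>, the left side is \<open>(h - 1) * (2 * k - 1)\<close>.\<close>

lemma max_essential_ge:
  "enat (m * (2 ^ d - 1)) \<le> max_essential G (Suc m) (2 ^ (d - 1))"
  using le_max_essentialI[OF basis_carrier _ inj_on_ess, of "Suc m" "2 ^ (d - 1)"]
    nfold_sumset_basis essential_ess card_ess(2) card_block_subsets by (simp add: almost_eq_def)

end

section \<open>From quotients of \<open>G\<close> to symmetric differences of coordinate
  sets\<close>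

lemma (in comm_group) sym_diff_hom_if_Mod_iso:
  assumes "subgroup H G" and iso: "G Mod H \<cong> product_group {..<D} (\<lambda>_. integer_mod_group 2)"
  obtains S :: "'a \<Rightarrow> nat set" where
    "\<And>x y. x \<in> carrier G \<Longrightarrow> y \<in> carrier G \<Longrightarrow> S (x \<otimes> y) = sym_diff (S x) (S y)"
    "S ` carrier G = Pow {..<D}"
proof -
  interpret H: normal H G using assms(1) by (rule subgroup_imp_normal)
  let ?V = "product_group {..<D} (\<lambda>_::nat. integer_mod_group 2)"
  from iso obtain \<psi> where \<psi>: "\<psi> \<in> iso (G Mod H) ?V" unfolding is_iso_def by blast
  define \<phi> where "\<phi> x = \<psi> (H #> x)" for x
  have hom: "\<phi> (x \<otimes> y) = \<phi> x \<otimes>\<^bsub>?V\<^esub> \<phi> y" if "x \<in> carrier G" "y \<in> carrier G" for x y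
  proof -
    have "H #> x \<in> carrier (G Mod H)" "H #> y \<in> carrier (G Mod H)"
      using that by (auto simp: FactGroup_def RCOSETS_def)
    then have "\<psi> ((H #> x) <#> (H #> y)) = \<psi> (H #> x) \<otimes>\<^bsub>?V\<^esub> \<psi> (H #> y)"
      using \<psi> by (auto simp: iso_def hom_def FactGroup_def)
    then show ?thesis using that by (simp add: \<phi>_def H.rcos_sum)
  qed
  have carV: "carrier ?V = PiE {..<D} (\<lambda>_. {0, 1::int})"
  proof -
    have "{0..<2} = {0, 1::int}" by auto
    then show ?thesis by (simp add: carrier_integer_mod_group)
  qed
  have "carrier (G Mod H) = (#>) H ` carrier G" by (auto simp: FactGroup_def RCOSETS_def)
  then have surj: "\<phi> ` carrier G = carrier ?V"
    using \<psi> unfolding iso_def bij_betw_def \<phi>_def by (simp add: image_image)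
  \<comment> \<open>A vector over the field with two elements is replaced by its support, which
    turns addition mod 2 into symmetric difference.\<close>
  define S where "S x = {i. i < D \<and> \<phi> x i = 1}" for x
  show thesis
  proof
    show "S (x \<otimes> y) = sym_diff (S x) (S y)" if "x \<in> carrier G" "y \<in> carrier G" for x y
    proof -
      have "\<phi> x \<in> carrier ?V" "\<phi> y \<in> carrier ?V" using surj that by blast+
      then have "\<phi> x i \<in> {0, 1}" "\<phi> y i \<in> {0, 1}" if "i < D" for i
        using that unfolding carV by (auto simp: PiE_iff)
      moreover have "\<phi> (x \<otimes> y) i = (\<phi> x i + \<phi> y i) mod 2" if "i < D" for i
        using hom[OF \<open>x \<in> carrier G\<close> \<open>y \<in> carrier G\<close>] that by (simp add: mult_integer_mod_group)
      ultimately have "\<phi> (x \<otimes> y) i = 1 \<longleftrightarrow> (\<phi> x i = 1 \<longleftrightarrow> \<phi> y i \<noteq> 1)" if "i < D" for i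
        using that by fastforce
      then show ?thesis unfolding S_def by blast
    qed
    show "S ` carrier G = Pow {..<D}"
    proof
      show "S ` carrier G \<subseteq> Pow {..<D}" by (auto simp: S_def)
      show "Pow {..<D} \<subseteq> S ` carrier G"
      proof
        fix P assume P: "P \<in> Pow {..<D}"
        \<comment> \<open>The indicator function of \<open>P\<close>; the restricted abstraction
          makes it extensional, as membership in \<open>PiE\<close> demands.\<close>
        let ?v = "\<lambda>i\<in>{..<D}. if i \<in> P then 1 else 0 :: int"
        have "?v \<in> carrier ?V" unfolding carV by auto
        then obtain x where x: "x \<in> carrier G" "\<phi> x = ?v" using surj by (metis imageE)
        then have "S x = P" using P by (auto simp: S_def split: if_splits)
        then show "P \<in> S ` carrier G" using x by blast
      qed
    qed
  qed
qed

lemma UN_blocks: "(\<Union>j<m. {j * d..<Suc j * d}) = {..<m * d :: nat}"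
proof (induction m)
  case (Suc m)
  have "{..<m * d} \<union> {m * d..<Suc m * d} = {..<Suc m * d}" by auto
  with Suc show ?case by (simp add: lessThan_Suc Un_commute)
qed simp

lemma blocks_disjoint:
  assumes "i \<noteq> j" shows "{i * d..<Suc i * d} \<inter> {j * d..<Suc j * d :: nat} = {}"
proof -
  have "{i * d..<Suc i * d} \<inter> {j * d..<Suc j * d} = {}" if "i < j" for i j
    using mult_le_mono1[of "Suc i" j d] that by auto
  then show ?thesis using assms by (metis Int_commute linorder_neqE_nat)
qed

text \<open>The \<open>m * d\<close> coordinates are cut into \<open>m\<close> consecutive intervals
  of length \<open>d\<close>, which serve as the blocks.\<close>

lemma (in comm_group) max_essential_ge_if_Mod_iso:
  assumes inf: "infinite (carrier G)" and "subgroup H G"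
    and "G Mod H \<cong> product_group {..<m * d} (\<lambda>_. integer_mod_group 2)"
  shows "enat (m * (2 ^ d - 1)) \<le> max_essential G (Suc m) (2 ^ (d - 1))"
proof -
  from sym_diff_hom_if_Mod_iso[OF assms(2,3)] obtain S :: "'a \<Rightarrow> nat set" where
    "\<And>x y. x \<in> carrier G \<Longrightarrow> y \<in> carrier G \<Longrightarrow> S (x \<otimes> y) = sym_diff (S x) (S y)"
    "S ` carrier G = Pow {..<m * d}" by blast
  then interpret boolean_quotient G S "\<lambda>j. {j * d..<Suc j * d}" m d
    using inf blocks_disjoint by unfold_locales (simp_all only: UN_blocks, auto)
  show ?thesis by (rule max_essential_ge)
qed

theorem theorem3:
  fixes G :: "('a, 'b) monoid_scheme"
  assumes "comm_group G" and "infinite (carrier G)"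
  shows "((\<forall>h k :: nat. h \<ge> 1 \<and> k \<ge> 1 \<longrightarrow> max_essential G h k = 0) \<longleftrightarrow>
           \<not> (\<exists>H. subgroup H G \<and> H \<noteq> carrier G \<and> finite (rcosets\<^bsub>G\<^esub> H))) \<and>
         ((\<forall>d::nat. d \<ge> 1 \<longrightarrow> (\<exists>H. subgroup H G \<and>
              G Mod H \<cong> product_group {..<d} (\<lambda>_. integer_mod_group 2))) \<longrightarrow>
           (\<forall>h::nat. h \<ge> 1 \<longrightarrow> infinite {k::nat. k \<ge> 1 \<and>
              enat ((h - 1) * (2 * k - 1)) \<le> max_essential G h k}))"
proof (intro conjI impI allI)
  interpret comm_group G by fact
  show "(\<forall>h k. h \<ge> 1 \<and> k \<ge> 1 \<longrightarrow> max_essential G h k = 0) \<longleftrightarrow>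
      \<not> (\<exists>H. subgroup H G \<and> H \<noteq> carrier G \<and> finite (rcosets\<^bsub>G\<^esub> H))"
    by (rule max_essential_eq_0_iff_no_finite_index[OF assms(2)])
  fix h :: nat
  assume quot: "\<forall>d::nat. d \<ge> 1 \<longrightarrow> (\<exists>H. subgroup H G \<and>
      G Mod H \<cong> product_group {..<d} (\<lambda>_. integer_mod_group 2))" and "h \<ge> 1"
  let ?K = "{k::nat. k \<ge> 1 \<and> enat ((h - 1) * (2 * k - 1)) \<le> max_essential G h k}"
  \<comment> \<open>Blocks of size \<open>Suc e\<close> yield essential subsets of size
    \<open>2 ^ e\<close>. For \<open>h = 1\<close> the bound is 0; it is split off because the
    hypothesis on quotients only covers positive ranks.\<close>
  have "2 ^ e \<in> ?K" for e
  proof (cases "h = 1")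
    case False
    then obtain m where m: "h = Suc m" "m \<ge> 1" using \<open>h \<ge> 1\<close> by (cases h) auto
    then have "m * Suc e \<ge> 1" by simp
    then obtain H where "subgroup H G"
      "G Mod H \<cong> product_group {..<m * Suc e} (\<lambda>_. integer_mod_group 2)" using quot by blast
    from max_essential_ge_if_Mod_iso[OF assms(2) this] show ?thesis using m by simp
  qed (simp add: zero_enat_def[symmetric])
  then have "range (\<lambda>e. 2 ^ e) \<subseteq> ?K" by blast
  moreover have "infinite (range (\<lambda>e. 2 ^ e :: nat))"
    by (intro range_inj_infinite) (simp add: inj_on_def)
  ultimately show "infinite ?K" using finite_subset by blast
qed

end
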